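(* Let $G$ be a graph on $n$ vertices containing no induced copy of $P_5$, and let $m:=\hom(G)$. If $m<n$, then there exist disjoint vertex sets $A,B\subseteq V(G)$ with $|A|,|B|\ge \frac{n}{m^{13}}$ such that there is no edge of $G$ between $A$ and $B$, and such that both induced subgraphs $G[A]$ and $G[B]$ are connected.
   Context: $P_5$ denotes the path on five vertices. A homogeneous set in $G$ is a set of vertices spanning a clique or an independent set, and $\hom(G)$ is the largest size of a homogeneous set in $G$. *)

theory Defs
  imports Complex_Main "Graph_Theory.Graph_Theory"
begin

text \<open>
  A finite simple graph is a \<open>pair_graph\<close>: every edge is represented by its two
  orientations, so \<open>parcs G\<close> is the (symmetric, irreflexive) adjacency relation.
\<close>

definition path_graph :: "nat \<Rightarrow> nat pair_pre_digraph" where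
  "path_graph k = \<lparr> pverts = {..<k},
     parcs = {(i, j). i < k \<and> j < k \<and> (j = Suc i \<or> i = Suc j)} \<rparr>"

definition contains_induced_copy :: "'a pair_pre_digraph \<Rightarrow> 'b pair_pre_digraph \<Rightarrow> bool" where
  "contains_induced_copy G H \<longleftrightarrow>
     (\<exists>S \<subseteq> pverts G. digraph_iso (with_proj H) (with_proj G \<restriction> S))"

definition is_clique :: "'a pair_pre_digraph \<Rightarrow> 'a set \<Rightarrow> bool" where
  "is_clique G S \<longleftrightarrow> S \<subseteq> pverts G \<and> (\<forall>u\<in>S. \<forall>v\<in>S. u \<noteq> v \<longrightarrow> (u, v) \<in> parcs G)"

definition is_independent :: "'a pair_pre_digraph \<Rightarrow> 'a set \<Rightarrow> bool" where
  "is_independent G S \<longleftrightarrow> S \<subseteq> pverts G \<and> (\<forall>u\<in>S. \<forall>v\<in>S. (u, v) \<notin> parcs G)"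

definition homogeneous :: "'a pair_pre_digraph \<Rightarrow> 'a set \<Rightarrow> bool" where
  "homogeneous G S \<longleftrightarrow> is_clique G S \<or> is_independent G S"

definition hom_number :: "'a pair_pre_digraph \<Rightarrow> nat" where
  "hom_number G = Max {card S |S. homogeneous G S}"

definition anticomplete :: "'a pair_pre_digraph \<Rightarrow> 'a set \<Rightarrow> 'a set \<Rightarrow> bool" where
  "anticomplete G A B \<longleftrightarrow> (\<forall>a\<in>A. \<forall>b\<in>B. (a, b) \<notin> parcs G)"

end

theory Submission
  imports Defs
begin

text \<open>
  If \<open>n \<le> m ^ 13\<close>, two nonadjacent vertices suffice. Otherwise count the induced copies of
  \<open>P4\<close> plus an isolated vertex \<open>w\<close>. A \<open>P4\<close>-free graph has at most (clique number) times
  (independence number) vertices, so every \<open>m\<^sup>2 + 1\<close> non-neighbours of \<open>w\<close> contain an induced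
  \<open>P4\<close>, and the non-neighbourhood of \<open>w\<close>, of size about \<open>n / m\<close> on average by Turan's theorem,
  contains at least about \<open>(n / m) ^ 4 / m ^ 8\<close> of them. Hence some induced path \<open>a b c\<close> has at least
  \<open>n / m ^ 12\<close> extensions \<open>d\<close> to an induced \<open>P4\<close> and at least \<open>n / m ^ 12\<close> common non-neighbours.
  An edge between these two sets would give an induced \<open>P5\<close>, and each of them has at most \<open>m\<close>
  components, so one of size at least \<open>n / m ^ 13\<close>.
\<close>

section \<open>\<open>P4\<close>-free graphs: vertices versus clique and independence
  numbers\<close>

definition induced_P4 :: "'a rel \<Rightarrow> 'a \<Rightarrow> 'a \<Rightarrow> 'a \<Rightarrow> 'a \<Rightarrow> bool" where
  "induced_P4 E a b c d \<longleftrightarrow> (a, b) \<in> E \<and> (b, c) \<in> E \<and> (c, d) \<in> E \<and>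
     (a, c) \<notin> E \<and> (a, d) \<notin> E \<and> (b, d) \<notin> E"

lemma induced_P4_distinct:
  assumes "sym E" "irrefl E" "induced_P4 E a b c d"
  shows "distinct [a, b, c, d]"
  using assms unfolding induced_P4_def by (auto simp: irrefl_def dest: symD)

text \<open>If \<open>I\<close> and \<open>K\<close> were disjoint, the neighbourhoods in
  \<open>K\<close> of the vertices of \<open>I\<close> would be nested, since two crossing ones give
  an induced \<open>P4\<close>. The largest of them would then contain every vertex of
  \<open>K\<close> that has a neighbour in \<open>I\<close>, which is all of \<open>K\<close> by
  maximality of \<open>I\<close>. Its owner could be added to \<open>K\<close>, against maximality
  of \<open>K\<close>.\<close>

lemma maximal_independent_meets_maximal_clique:
  assumes "sym E" "irrefl E" "finite S"
    and free: "\<And>a b c d. {a, b, c, d} \<subseteq> S \<Longrightarrow> \<not> induced_P4 E a b c d"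
    and "I \<subseteq> S" "pairwise (\<lambda>u v. (u, v) \<notin> E) I"
    and maxI: "\<And>v. v \<in> S - I \<Longrightarrow> \<exists>u\<in>I. (u, v) \<in> E"
    and "K \<subseteq> S" "pairwise (\<lambda>u v. (u, v) \<in> E) K" "K \<noteq> {}"
    and maxK: "\<And>v. v \<in> S - K \<Longrightarrow> \<exists>u\<in>K. (u, v) \<notin> E"
  shows "I \<inter> K \<noteq> {}"
proof
  assume disj: "I \<inter> K = {}"
  define N where "N i = {k \<in> K. (i, k) \<in> E}" for i
  have finite: "finite I" "finite K" "finite (N i)" for i
    using assms by (auto simp: N_def intro: finite_subset)
  have "I \<noteq> {}" using maxI \<open>K \<noteq> {}\<close> \<open>K \<subseteq> S\<close> by blast
  then obtain i where i: "i \<in> I" and imax: "\<And>j. j \<in> I \<Longrightarrow> card (N j) \<le> card (N i)"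
    using Max_in[of "(\<lambda>i. card (N i)) ` I"] Max_ge[of "(\<lambda>i. card (N i)) ` I"] finite(1)
    by fastforce
  obtain k where k: "k \<in> K" "(k, i) \<notin> E" using maxK[of i] i disj \<open>I \<subseteq> S\<close> by blast
  obtain j where j: "j \<in> I" "(j, k) \<in> E" using maxI[of k] k disj \<open>K \<subseteq> S\<close> by blast
  \<comment> \<open>\<open>j\<close> sees \<open>k\<close> and \<open>i\<close> does not, so maximality of \<open>N i\<close> yields \<open>k'\<close> with \<open>i k' k j\<close> induced.\<close>
  have "\<not> N i \<subseteq> N j"
  proof
    assume "N i \<subseteq> N j"
    moreover have "k \<in> N j - N i" using k j symD[OF \<open>sym E\<close>] by (auto simp: N_def)
    ultimately have "card (N i) < card (N j)" by (intro psubset_card_mono finite) auto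
    then show False using imax[OF j(1)] by simp
  qed
  then obtain k' where k': "k' \<in> K" "(i, k') \<in> E" "(j, k') \<notin> E" by (auto simp: N_def)
  have "k' \<noteq> k" using k' j by auto
  then have "(k', k) \<in> E" using \<open>pairwise _ K\<close> k k' by (auto simp: pairwise_def)
  moreover have "(i, j) \<notin> E"
    using \<open>pairwise _ I\<close> i j \<open>irrefl E\<close> by (cases "i = j") (auto simp: pairwise_def irrefl_def)
  ultimately have "induced_P4 E i k' k j"
    using k k' j symD[OF \<open>sym E\<close>] by (auto simp: induced_P4_def)
  moreover have "{i, k', k, j} \<subseteq> S" using i j k k' \<open>I \<subseteq> S\<close> \<open>K \<subseteq> S\<close> by auto
  ultimately show False using free by blast
qed

text \<open>Induction on the clique bound \<open>p\<close>. A largest independent set meets every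
  maximal clique, so deleting it costs at most \<open>q\<close> vertices and lowers the clique bound
  by one.\<close>

lemma P4_free_card_le:
  assumes "sym E" "irrefl E" "finite S"
    and "\<And>a b c d. {a, b, c, d} \<subseteq> S \<Longrightarrow> \<not> induced_P4 E a b c d"
    and "\<And>K. K \<subseteq> S \<Longrightarrow> pairwise (\<lambda>u v. (u, v) \<in> E) K \<Longrightarrow> card K \<le> p"
    and "\<And>I. I \<subseteq> S \<Longrightarrow> pairwise (\<lambda>u v. (u, v) \<notin> E) I \<Longrightarrow> card I \<le> q"
  shows "card S \<le> p * q"
  using assms(3-)
proof (induction p arbitrary: S)
  case 0
  have "S = {}"
  proof (rule ccontr)
    assume "S \<noteq> {}"
    then obtain x where "x \<in> S" by blast
    then show False using 0(3)[of "{x}"] by simp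
  qed
  then show ?case by simp
next
  case (Suc p)
  define P where "P I \<longleftrightarrow> I \<subseteq> S \<and> pairwise (\<lambda>u v. (u, v) \<notin> E) I" for I
  have "\<exists>I. P I \<and> (\<forall>J. P J \<longrightarrow> card J \<le> card I)"
    by (rule ex_has_greatest_nat[of P "{}" card "Suc (card S)"])
      (use Suc.prems(1) in \<open>auto simp: P_def card_mono less_Suc_eq_le\<close>)
  then obtain I where I: "I \<subseteq> S" "pairwise (\<lambda>u v. (u, v) \<notin> E) I"
    and Imax: "\<And>J. P J \<Longrightarrow> card J \<le> card I" by (auto simp: P_def)
  have finI: "finite I" using I Suc.prems(1) finite_subset by blast
  have maxI: "\<exists>u\<in>I. (u, v) \<in> E" if v: "v \<in> S - I" for v
  proof (rule ccontr)
    assume "\<not> ?thesis"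
    then have "P (insert v I)" using I v symD[OF \<open>sym E\<close>] by (auto simp: P_def pairwise_insert)
    from Imax[OF this] show False using v finI by simp
  qed
  have "card (S - I) \<le> p * q"
  proof (rule Suc.IH)
    fix K assume K: "K \<subseteq> S - I" "pairwise (\<lambda>u v. (u, v) \<in> E) K"
    show "card K \<le> p"
    proof (rule ccontr)
      assume "\<not> card K \<le> p"
      have finK: "finite K" using K Suc.prems(1) finite_subset by blast
      \<comment> \<open>A clique of more than \<open>p\<close> vertices already attains the bound
        \<open>Suc p\<close> on \<open>S\<close>, so it is maximal in all of \<open>S\<close> and
        must meet \<open>I\<close>.\<close>
      have maxK: "\<exists>u\<in>K. (u, v) \<notin> E" if v: "v \<in> S - K" for v
      proof (rule ccontr)
        assume "\<not> ?thesis"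
        then have "pairwise (\<lambda>u v. (u, v) \<in> E) (insert v K)"
          using K v symD[OF \<open>sym E\<close>] by (auto simp: pairwise_insert)
        then have "card (insert v K) \<le> Suc p" using K v by (intro Suc.prems(3)) auto
        then show False using v finK \<open>\<not> card K \<le> p\<close> by simp
      qed
      have "K \<noteq> {}" using \<open>\<not> card K \<le> p\<close> by auto
      have "I \<inter> K \<noteq> {}"
        by (rule maximal_independent_meets_maximal_clique[OF assms(1,2) Suc.prems(1,2) I maxI _ K(2) _ maxK])
          (use K \<open>K \<noteq> {}\<close> in auto)
      then show False using K by blast
    qed
  next
    show "finite (S - I)" using Suc.prems(1) by simp
    show "\<not> induced_P4 E a b c d" if "{a, b, c, d} \<subseteq> S - I" for a b c d
      using Suc.prems(2) that by blast
    show "card J \<le> q" if "J \<subseteq> S - I" "pairwise (\<lambda>u v. (u, v) \<notin> E) J" for J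
      using Suc.prems(4) that by blast
  qed
  moreover have "card S = card I + card (S - I)"
    using I(1) finI Suc.prems(1) by (simp add: card_Diff_subset card_mono)
  moreover have "card I \<le> q" using Suc.prems(4) I by blast
  ultimately show ?case by simp
qed

section \<open>Two averaging tools: supersaturation and Turan's theorem\<close>

lemma card_supersets_of_size:
  assumes "finite M" "F \<subseteq> M" "card F \<le> s"
  shows "card {X. F \<subseteq> X \<and> X \<subseteq> M \<and> card X = s} = (card M - card F) choose (s - card F)"
proof -
  have finF: "finite F" using assms finite_subset by blast
  have "bij_betw (\<lambda>Y. F \<union> Y) {Y. Y \<subseteq> M - F \<and> card Y = s - card F}
          {X. F \<subseteq> X \<and> X \<subseteq> M \<and> card X = s}"
  proof (rule bij_betw_byWitness[where f' = "\<lambda>X. X - F"])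
    show "(\<lambda>Y. F \<union> Y) ` {Y. Y \<subseteq> M - F \<and> card Y = s - card F}
        \<subseteq> {X. F \<subseteq> X \<and> X \<subseteq> M \<and> card X = s}"
    proof safe
      fix Y assume Y: "Y \<subseteq> M - F" "card Y = s - card F"
      have "finite Y" using Y assms(1) finite_subset by blast
      then have "card (F \<union> Y) = card F + card Y" using Y finF by (intro card_Un_disjoint) auto
      then show "card (F \<union> Y) = s" using Y assms(3) by simp
    qed (use assms in auto)
    show "(\<lambda>X. X - F) ` {X. F \<subseteq> X \<and> X \<subseteq> M \<and> card X = s}
        \<subseteq> {Y. Y \<subseteq> M - F \<and> card Y = s - card F}"
      using finF by (auto simp: card_Diff_subset)
  qed auto
  then have "card {X. F \<subseteq> X \<and> X \<subseteq> M \<and> card X = s} = card {Y. Y \<subseteq> M - F \<and> card Y = s - card F}"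
    by (simp add: bij_betw_same_card)
  also have "\<dots> = card (M - F) choose (s - card F)" using assms by (simp add: n_subsets)
  also have "card (M - F) = card M - card F" using assms finF by (simp add: card_Diff_subset)
  finally show ?thesis .
qed

text \<open>Supersaturation: if every \<open>s\<close>-subset contains some pattern
  \<open>f x\<close>, there are many patterns. Each pattern lies in only
  \<open>(card M - j) choose (s - j)\<close> of the \<open>s\<close>-subsets, so a union bound over
  \<open>P\<close> must cover all of them.\<close>

lemma choose_le_card_hitting_family:
  assumes "finite M" "finite P" "s \<le> card M" "j \<le> s"
    and f: "\<And>x. x \<in> P \<Longrightarrow> f x \<subseteq> M \<and> card (f x) = j"
    and hit: "\<And>X. X \<subseteq> M \<Longrightarrow> card X = s \<Longrightarrow> \<exists>x\<in>P. f x \<subseteq> X"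
  shows "card M choose j \<le> card P * (s choose j)"
proof -
  have "card M choose s = card {X. X \<subseteq> M \<and> card X = s}" using assms(1) by (simp add: n_subsets)
  also have "\<dots> \<le> card (\<Union>x\<in>P. {X. f x \<subseteq> X \<and> X \<subseteq> M \<and> card X = s})"
  proof (rule card_mono)
    show "finite (\<Union>x\<in>P. {X. f x \<subseteq> X \<and> X \<subseteq> M \<and> card X = s})"
      using assms(1,2) by auto
  qed (use hit in blast)
  also have "\<dots> \<le> (\<Sum>x\<in>P. card {X. f x \<subseteq> X \<and> X \<subseteq> M \<and> card X = s})"
    using assms(2) by (rule card_UN_le)
  also have "\<dots> = card P * ((card M - j) choose (s - j))"
    using assms(1,4) f by (simp add: card_supersets_of_size)
  finally have "(card M choose s) * (s choose j) \<le> card P * (s choose j) * ((card M - j) choose (s - j))"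
    by (simp add: mult.commute mult.left_commute)
  \<comment> \<open>Both sides of the identity behind \<open>choose_mult\<close> count pairs of a
    \<open>j\<close>-set inside an \<open>s\<close>-set of \<open>M\<close>; using it, the common
    factor cancels.\<close>
  then have "(card M choose j) * ((card M - j) choose (s - j))
      \<le> card P * (s choose j) * ((card M - j) choose (s - j))"
    using choose_mult[of j s "card M"] assms(3,4) by simp
  moreover have "((card M - j) choose (s - j)) > 0" using assms(3,4) by simp
  ultimately show ?thesis by simp
qed

text \<open>Turan's theorem for the complement graph, with loops: \<open>R\<close> is non-adjacency.\<close>
lemma card_square_le_clique_bound:
  assumes "finite S" "\<And>u. u \<in> S \<Longrightarrow> (u, u) \<in> R" "sym R"
    and "\<And>K. K \<subseteq> S \<Longrightarrow> pairwise (\<lambda>u v. (u, v) \<notin> R) K \<Longrightarrow> card K \<le> p"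
  shows "(card S)\<^sup>2 \<le> p * (\<Sum>u\<in>S. card {v \<in> S. (u, v) \<in> R})"
  using assms
proof (induction p arbitrary: S)
  case 0
  have "S = {}"
  proof (rule ccontr)
    assume "S \<noteq> {}"
    then obtain x where "x \<in> S" by blast
    then show False using 0(4)[of "{x}"] by simp
  qed
  then show ?case by simp
next
  case (Suc p)
  define deg where "deg A u = card {v \<in> A. (u, v) \<in> R}" for A u
  show ?case
  proof (cases "S = {}")
    case False
    \<comment> \<open>A vertex \<open>w\<close> of least \<open>R\<close>-degree. The set
      \<open>S'\<close> left after removing its \<open>R\<close>-neighbours \<open>D\<close>
      consists of vertices outside \<open>R\<close> with \<open>w\<close>, so adding
      \<open>w\<close> to a clique of \<open>S'\<close> enlarges it: this is what lets the bound
      drop from \<open>Suc p\<close> to \<open>p\<close>.\<close>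
    then obtain w where w: "w \<in> S" and wmin: "\<And>u. u \<in> S \<Longrightarrow> deg S w \<le> deg S u"
      using Suc.prems(1) by (metis arg_min_if_finite(1) arg_min_least)
    define D where "D = {v \<in> S. (w, v) \<in> R}"
    define S' where "S' = S - D"
    have "D \<subseteq> S" "S' \<subseteq> S" by (auto simp: D_def S'_def)
    have fin: "finite D" "finite S'" using Suc.prems(1) by (auto simp: D_def S'_def)
    have "card S = card D + card S'"
      unfolding S'_def using \<open>D \<subseteq> S\<close> fin Suc.prems(1)
      by (simp add: card_Diff_subset card_mono)
    have IH: "(card S')\<^sup>2 \<le> p * (\<Sum>u\<in>S'. deg S' u)"
      unfolding deg_def
    proof (rule Suc.IH)
      fix K assume K: "K \<subseteq> S'" "pairwise (\<lambda>u v. (u, v) \<notin> R) K"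
      have "finite K" "w \<notin> K"
        using K fin finite_subset w Suc.prems(2) by (auto simp: S'_def D_def)
      have "pairwise (\<lambda>u v. (u, v) \<notin> R) (insert w K)"
        using K symD[OF \<open>sym R\<close>] by (auto simp: pairwise_insert S'_def D_def)
      then have "card (insert w K) \<le> Suc p"
        using K w \<open>S' \<subseteq> S\<close> by (intro Suc.prems(4)) auto
      then show "card K \<le> p" using \<open>finite K\<close> \<open>w \<notin> K\<close> by simp
    qed (use Suc.prems fin \<open>S' \<subseteq> S\<close> in auto)
    have "(\<Sum>u\<in>S. deg S u) = (\<Sum>u\<in>D. deg S u) + (\<Sum>u\<in>S'. deg S u)"
      unfolding S'_def using sum.subset_diff[OF \<open>D \<subseteq> S\<close> Suc.prems(1), of "deg S"] by simp
    moreover have "(\<Sum>u\<in>D. card D) \<le> (\<Sum>u\<in>D. deg S u)"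
      using wmin by (intro sum_mono) (auto simp: D_def deg_def)
    moreover have "(\<Sum>u\<in>S'. deg S' u) \<le> (\<Sum>u\<in>S'. deg S u)"
      unfolding deg_def using \<open>S' \<subseteq> S\<close> Suc.prems(1) by (intro sum_mono card_mono) auto
    ultimately have sum: "(\<Sum>u\<in>S. deg S u) \<ge> (card D)\<^sup>2 + (\<Sum>u\<in>S'. deg S' u)"
      by (simp add: power2_eq_square)
    define x y e where "x = int (card D)" and "y = int (card S')" and "e = int (\<Sum>u\<in>S'. deg S' u)"
    have y: "y\<^sup>2 \<le> int p * e"
      using IH unfolding y_def e_def by (metis of_nat_le_iff of_nat_mult of_nat_power)
    \<comment> \<open>Cauchy-Schwarz with weights 1 and \<open>p\<close>, where \<open>e\<close>
      stands in for the quotient of the square of \<open>y\<close> by \<open>p\<close>. It comes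
      from the square of \<open>p * x - y\<close>; for \<open>p = 0\<close> the bound on
      \<open>y\<close> forces \<open>y = 0\<close>.\<close>
    have "(x + y)\<^sup>2 \<le> (int p + 1) * (x\<^sup>2 + e)"
    proof (cases "p = 0")
      case True
      then have "y = 0" "e \<ge> 0" using y by (simp_all add: e_def sum_nonneg)
      then show ?thesis using True by simp
    next
      case False
      have "0 \<le> (int p * x - y)\<^sup>2" by simp
      then have "int p * (2 * x * y) \<le> int p * (int p * x\<^sup>2) + y\<^sup>2"
        by (simp add: power2_eq_square algebra_simps)
      also have "\<dots> \<le> int p * (int p * x\<^sup>2) + int p * e" using y by simp
      finally have "int p * (2 * x * y) \<le> int p * (int p * x\<^sup>2 + e)" by (simp add: algebra_simps)
      then have "2 * x * y \<le> int p * x\<^sup>2 + e" using False by simp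
      then show ?thesis using y by (simp add: power2_eq_square algebra_simps)
    qed
    also have "\<dots> \<le> (int p + 1) * int (\<Sum>u\<in>S. deg S u)"
    proof (rule mult_left_mono)
      have "x\<^sup>2 + e = int ((card D)\<^sup>2 + (\<Sum>u\<in>S'. deg S' u))" by (simp add: x_def e_def)
      then show "x\<^sup>2 + e \<le> int (\<Sum>u\<in>S. deg S u)" using sum by (simp only: of_nat_le_iff)
    qed simp
    finally have "int ((card S)\<^sup>2) \<le> int (Suc p * (\<Sum>u\<in>S. deg S u))"
      using \<open>card S = _\<close> by (simp add: x_def y_def algebra_simps)
    then show ?thesis unfolding deg_def by linarith
  qed simp
qed

section \<open>Counting induced \<open>P4\<close>s in one vertex set\<close>

lemma real_choose_4:
  "real (k choose 4) = real k * (real k - 1) * (real k - 2) * (real k - 3) / 24"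
  by (simp add: binomial_gbinomial gbinomial_prod_rev numeral_eq_Suc field_simps)

text \<open>The lower bound is linear in \<open>k\<close>, so it can be summed knowing only the average of \<open>k\<close>.\<close>
lemma falling_factorial_4_ge_tangent:
  fixes x :: real
  assumes "x \<ge> 0"
  shows "4 * x ^ 3 * (real k - 3) - 3 * x ^ 4 \<le> real k * (real k - 1) * (real k - 2) * (real k - 3)"
proof (cases "k \<ge> 3")
  case True
  define y where "y = real k - 3"
  have "y \<ge> 0" using True by (simp add: y_def)
  \<comment> \<open>The tangent to \<open>y ^ 4\<close> at \<open>x\<close> is
    \<open>4 * x ^ 3 * y - 3 * x ^ 4\<close>; the gap between curve and tangent has a double root at
    \<open>x\<close>.\<close>
  have "0 \<le> (y - x)\<^sup>2 * (y\<^sup>2 + 2 * x * y + 3 * x\<^sup>2)" using assms \<open>y \<ge> 0\<close> by simp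
  also have "\<dots> = y ^ 4 - 4 * x ^ 3 * y + 3 * x ^ 4" by algebra
  finally have "4 * x ^ 3 * y - 3 * x ^ 4 \<le> y ^ 4" by simp
  also have "y ^ 4 \<le> (y + 3) * (y + 2) * (y + 1) * y"
    using \<open>y \<ge> 0\<close> by (simp add: power4_eq_xxxx) (intro mult_mono mult_nonneg_nonneg; simp)
  finally show ?thesis by (simp add: y_def algebra_simps)
next
  case False
  \<comment> \<open>Here the product vanishes, while \<open>real k - 3\<close> is negative and so
    the left side is at most 0.\<close>
  then have "k = 0 \<or> k = 1 \<or> k = 2" by auto
  moreover have "x ^ 3 \<ge> 0" "x ^ 4 \<ge> 0" using assms by simp_all
  ultimately show ?thesis by (elim disjE; simp; linarith)
qed

text \<open>Supersaturation with 4-sets inside sets of size \<open>s = m ^ 2 + 1\<close>, each of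
  which contains an induced \<open>P4\<close>; the last factor is
  \<open>s * (s - 1) * (s - 2) * (s - 3)\<close>. The condition on \<open>x\<close> makes the
  tangent bound nonpositive when \<open>M\<close> has fewer than \<open>s\<close> vertices, so the
  estimate holds for every \<open>M\<close> and can be summed.\<close>

lemma count_induced_P4_ge:
  fixes x :: real
  assumes "sym E" "irrefl E" "finite M" "m \<ge> 2" "x \<ge> 2 * real m ^ 2"
    and cl: "\<And>K. K \<subseteq> M \<Longrightarrow> pairwise (\<lambda>u v. (u, v) \<in> E) K \<Longrightarrow> card K \<le> m"
    and ind: "\<And>I. I \<subseteq> M \<Longrightarrow> pairwise (\<lambda>u v. (u, v) \<notin> E) I \<Longrightarrow> card I \<le> m"
  defines "P \<equiv> {(a, b, c, d). {a, b, c, d} \<subseteq> M \<and> induced_P4 E a b c d}"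
  shows "4 * x ^ 3 * (real (card M) - 3) - 3 * x ^ 4
    \<le> real (card P) * ((real m ^ 2 + 1) * real m ^ 2 * (real m ^ 2 - 1) * (real m ^ 2 - 2))"
proof -
  define s where "s = m\<^sup>2 + 1"
  define q where "q = (real m ^ 2 + 1) * real m ^ 2 * (real m ^ 2 - 1) * (real m ^ 2 - 2)"
  have "m\<^sup>2 \<ge> 2\<^sup>2" using \<open>m \<ge> 2\<close> by (rule power_mono) simp
  have m2: "real m ^ 2 \<ge> 4" using power_mono[of 2 "real m" 2] \<open>m \<ge> 2\<close> by simp
  from m2 have "q \<ge> 0" by (simp add: q_def)
  have "x \<ge> 0" using assms(5) m2 by linarith
  show ?thesis
  proof (cases "s \<le> card M")
    case True
    have finP: "finite P"
      by (rule finite_subset[of _ "M \<times> M \<times> M \<times> M"]) (use \<open>finite M\<close> in \<open>auto simp: P_def\<close>)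
    have "card M choose 4 \<le> card P * (s choose 4)"
    proof (rule choose_le_card_hitting_family[OF \<open>finite M\<close> finP True])
      show "4 \<le> s" using \<open>m\<^sup>2 \<ge> 2\<^sup>2\<close> by (simp add: s_def)
      show "(case p of (a, b, c, d) \<Rightarrow> {a, b, c, d}) \<subseteq> M \<and>
          card (case p of (a, b, c, d) \<Rightarrow> {a, b, c, d}) = 4" if "p \<in> P" for p
        using that induced_P4_distinct[OF \<open>sym E\<close> \<open>irrefl E\<close>] by (fastforce simp: P_def)
    next
      fix X assume X: "X \<subseteq> M" "card X = s"
      have "finite X" using X \<open>finite M\<close> finite_subset by blast
      show "\<exists>p\<in>P. (case p of (a, b, c, d) \<Rightarrow> {a, b, c, d}) \<subseteq> X"
      proof (rule ccontr)
        assume none: "\<not> ?thesis"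
        have "card X \<le> m * m"
        proof (rule P4_free_card_le[OF \<open>sym E\<close> \<open>irrefl E\<close> \<open>finite X\<close>])
          show "\<not> induced_P4 E a b c d" if "{a, b, c, d} \<subseteq> X" for a b c d
          proof
            assume "induced_P4 E a b c d"
            then have "(a, b, c, d) \<in> P" using that X by (auto simp: P_def)
            then show False using none that by force
          qed
        qed (use X cl ind in \<open>blast+\<close>)
        then show False using X by (simp add: s_def power2_eq_square)
      qed
    qed
    then have "real (card M choose 4) \<le> real (card P) * real (s choose 4)"
      by (metis of_nat_le_iff of_nat_mult)
    then have "real (card M) * (real (card M) - 1) * (real (card M) - 2) * (real (card M) - 3)
        \<le> real (card P) * (real s * (real s - 1) * (real s - 2) * (real s - 3))"
      unfolding real_choose_4 by (simp add: divide_right_mono)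
    also have "real s * (real s - 1) * (real s - 2) * (real s - 3) = q"
      by (simp add: s_def q_def)
    finally show ?thesis
      using falling_factorial_4_ge_tangent[OF \<open>x \<ge> 0\<close>, of "card M"] by (simp add: q_def)
  next
    case False
    then have "card M \<le> m\<^sup>2" by (simp add: s_def)
    then have "real (card M) \<le> real m ^ 2" by (metis of_nat_le_iff of_nat_power)
    then have "4 * (real (card M) - 3) \<le> 3 * x" using assms(5) m2 by argo
    then have "x ^ 3 * (4 * (real (card M) - 3)) \<le> x ^ 3 * (3 * x)"
      using \<open>x \<ge> 0\<close> by (intro mult_left_mono) auto
    then have "4 * x ^ 3 * (real (card M) - 3) - 3 * x ^ 4 \<le> 0"
      by (simp add: power_numeral_reduce algebra_simps)
    also have "0 \<le> real (card P) * q" using \<open>q \<ge> 0\<close> by simp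
    finally show ?thesis by (simp add: q_def)
  qed
qed

section \<open>The averaging argument for an induced three-vertex path\<close>

text \<open>The loss from \<open>y\<close> to \<open>y - 4\<close> is a factor of about
  \<open>1 - 16 / y\<close>. It is absorbed because the product on the left falls short of
  \<open>m ^ 8\<close> by a factor of about \<open>1 - 2 / m ^ 2\<close>, which is smaller once
  \<open>y > 8 * m ^ 2\<close>.\<close>

lemma fourth_power_shift_estimate:
  fixes m y :: real
  assumes "m \<ge> 2" "y > m ^ 12"
  shows "(m\<^sup>2 + 1) * m\<^sup>2 * (m\<^sup>2 - 1) * (m\<^sup>2 - 2) * y ^ 4 < m ^ 8 * (y - 4) ^ 4"
    and "y - 4 \<ge> 2 * m\<^sup>2"
proof -
  have m2: "m\<^sup>2 \<ge> 4" using power_mono[OF assms(1), of 2] by simp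
  have "m ^ 10 \<ge> 1024" using power_mono[OF assms(1), of 10] by simp
  then have "m ^ 10 * m\<^sup>2 \<ge> 1024 * m\<^sup>2" by (intro mult_right_mono) auto
  then have y: "y > 1024 * m\<^sup>2" using assms(2) by (simp flip: power_add)
  then show "y - 4 \<ge> 2 * m\<^sup>2" using m2 by simp
  have "y > 4" using y m2 by linarith
  have q: "(m\<^sup>2 + 1) * m\<^sup>2 * (m\<^sup>2 - 1) * (m\<^sup>2 - 2) = m ^ 8 - 2 * m ^ 6 - m\<^sup>2 * (m\<^sup>2 - 2)"
    by algebra
  have "m\<^sup>2 * (m\<^sup>2 - 2) \<ge> 0" using m2 by simp
  then have "(m\<^sup>2 + 1) * m\<^sup>2 * (m\<^sup>2 - 1) * (m\<^sup>2 - 2) * y ^ 4 \<le> (m ^ 8 - 2 * m ^ 6) * y ^ 4"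
    unfolding q using \<open>y > 4\<close> by (intro mult_right_mono) auto
  also have "\<dots> = m ^ 8 * y ^ 4 - (2 * m ^ 6 * y ^ 3) * y" by algebra
  also have "\<dots> < m ^ 8 * y ^ 4 - (2 * m ^ 6 * y ^ 3) * (8 * m\<^sup>2)"
  proof -
    have "2 * m ^ 6 * y ^ 3 > 0" using assms \<open>y > 4\<close> by simp
    moreover have "8 * m\<^sup>2 < y" using y m2 by linarith
    ultimately show ?thesis using mult_strict_left_mono by (metis diff_strict_left_mono)
  qed
  also have "\<dots> = m ^ 8 * (y ^ 4 - 16 * y ^ 3)" by algebra
  also have "\<dots> \<le> m ^ 8 * (y - 4) ^ 4"
  proof (rule mult_left_mono)
    have "(y - 4) ^ 4 = y ^ 4 - 16 * y ^ 3 + (96 * y * (y - 4) + 128 * y + 256)" by algebra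
    moreover have "96 * y * (y - 4) \<ge> 0" using \<open>y > 4\<close> by simp
    ultimately show "y ^ 4 - 16 * y ^ 3 \<le> (y - 4) ^ 4" using \<open>y > 4\<close> by simp
  qed simp
  finally show "(m\<^sup>2 + 1) * m\<^sup>2 * (m\<^sup>2 - 1) * (m\<^sup>2 - 2) * y ^ 4 < m ^ 8 * (y - 4) ^ 4" .
qed

text \<open>Double counting of pairs of a vertex \<open>w\<close> and an induced \<open>P4\<close>
  among its non-neighbours. Grouping by the first three path vertices gives an upper bound if the
  claim fails; grouping by \<open>w\<close> gives a larger lower bound.\<close>

lemma ex_P3_with_large_attachments:
  assumes "sym E" "irrefl E" "finite V" "m \<ge> 2" and large: "card V > m ^ 13"
    and cl: "\<And>K. K \<subseteq> V \<Longrightarrow> pairwise (\<lambda>u v. (u, v) \<in> E) K \<Longrightarrow> card K \<le> m"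
    and ind: "\<And>I. I \<subseteq> V \<Longrightarrow> pairwise (\<lambda>u v. (u, v) \<notin> E) I \<Longrightarrow> card I \<le> m"
  shows "\<exists>a\<in>V. \<exists>b\<in>V. \<exists>c\<in>V. (a, b) \<in> E \<and> (b, c) \<in> E \<and> (a, c) \<notin> E \<and>
    real (card V) / real m ^ 12 \<le> real (card {d \<in> V. induced_P4 E a b c d}) \<and>
    real (card V) / real m ^ 12 \<le> real (card {w \<in> V. (a, w) \<notin> E \<and> (b, w) \<notin> E \<and> (c, w) \<notin> E})"
proof (rule ccontr)
  assume none: "\<not> ?thesis"
  define n where "n = card V"
  define D W where "D = (\<lambda>(a, b, c). {d \<in> V. induced_P4 E a b c d})"
    and "W = (\<lambda>(a, b, c). {w \<in> V. (a, w) \<notin> E \<and> (b, w) \<notin> E \<and> (c, w) \<notin> E})"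
  define T where "T = {(a, b, c). {a, b, c} \<subseteq> V \<and> (a, b) \<in> E \<and> (b, c) \<in> E \<and> (a, c) \<notin> E}"
  define M where "M w = {u \<in> V. (w, u) \<notin> E} - {w}" for w
  define P where "P w = {(a, b, c, d). {a, b, c, d} \<subseteq> M w \<and> induced_P4 E a b c d}" for w
  define t where "t = real n / real m ^ 12"
  define y where "y = real n / real m"
  define q where "q = (real m ^ 2 + 1) * real m ^ 2 * (real m ^ 2 - 1) * (real m ^ 2 - 2)"
  have mpos: "real m > 0" "real m \<ge> 2" using \<open>m \<ge> 2\<close> by auto
  have n: "real n > real m ^ 13" using large unfolding n_def by (metis of_nat_less_iff of_nat_power)
  have npos: "real n > 0" using n mpos by (meson order_le_less_trans zero_le_power less_imp_le)
  have y: "y > real m ^ 12"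
    using n mpos by (simp add: y_def field_simps power_numeral_reduce)
  have finM: "finite (M w)" for w using \<open>finite V\<close> by (simp add: M_def)
  have finP: "finite (P w)" for w
    by (rule finite_subset[of _ "M w \<times> M w \<times> M w \<times> M w"]) (use finM in \<open>auto simp: P_def\<close>)
  have TV: "T \<subseteq> V \<times> V \<times> V" by (auto simp: T_def)
  then have finT: "finite T" using \<open>finite V\<close> by (meson finite_SigmaI finite_subset)
  have fin: "finite (D p)" "finite (W p)" for p using \<open>finite V\<close> by (auto simp: D_def W_def split: prod.split)
  have "card T \<le> n ^ 3"
    using card_mono[OF _ TV] \<open>finite V\<close> by (simp add: n_def card_cartesian_product power3_eq_cube mult.assoc)

  \<comment> \<open>Regrouping the tuples forgets that \<open>d\<close> and \<open>w\<close> are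
    nonadjacent, hence only an inequality.\<close>
  have "(\<Sum>w\<in>V. card (P w)) = card (SIGMA w:V. P w)" using \<open>finite V\<close> finP by simp
  also have "\<dots> \<le> card (SIGMA p:T. D p \<times> W p)"
  proof (rule card_inj_on_le)
    let ?f = "\<lambda>(w, a, b, c, d). ((a, b, c), d, w)"
    show "inj_on ?f (SIGMA w:V. P w)" by (auto simp: inj_on_def)
    show "?f ` (SIGMA w:V. P w) \<subseteq> (SIGMA p:T. D p \<times> W p)"
      using symD[OF \<open>sym E\<close>] by (auto simp: P_def M_def T_def D_def W_def induced_P4_def)
    show "finite (SIGMA p:T. D p \<times> W p)" using finT fin by auto
  qed
  also have "\<dots> = (\<Sum>p\<in>T. card (D p) * card (W p))"
    using finT fin by (simp add: card_cartesian_product)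
  finally have "real (\<Sum>w\<in>V. card (P w)) \<le> (\<Sum>p\<in>T. real (card (D p)) * real (card (W p)))"
    by (metis (mono_tags, lifting) of_nat_le_iff of_nat_mult of_nat_sum sum.cong)
  also have "\<dots> \<le> (\<Sum>p\<in>T. t * real n)"
  proof (rule sum_mono)
    fix p assume "p \<in> T"
    then have "real (card (D p)) < t \<or> real (card (W p)) < t"
      using none unfolding T_def D_def W_def t_def n_def by fastforce
    moreover have "card (D p) \<le> n" "card (W p) \<le> n"
      unfolding n_def D_def W_def using \<open>finite V\<close> by (auto split: prod.split intro!: card_mono)
    moreover have "t \<ge> 0" by (simp add: t_def)
    ultimately show "real (card (D p)) * real (card (W p)) \<le> t * real n"
      by (metis less_imp_le mult.commute mult_mono of_nat_0_le_iff of_nat_le_iff)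
  qed
  also have "\<dots> \<le> real (n ^ 3) * (t * real n)"
  proof -
    have "real (card T) \<le> real (n ^ 3)" using \<open>card T \<le> n ^ 3\<close> by (simp only: of_nat_le_iff)
    then have "real (card T) * (t * real n) \<le> real (n ^ 3) * (t * real n)"
      by (intro mult_right_mono) (auto simp: t_def)
    then show ?thesis by simp
  qed
  finally have upper: "real (\<Sum>w\<in>V. card (P w)) \<le> real n ^ 4 * t"
    by (simp add: power_numeral_reduce algebra_simps)

  \<comment> \<open>The relation \<open>- E\<close> contains the loops, so each degree counts
    \<open>w\<close> itself: this is the \<open>+ 1\<close> over \<open>card (M w)\<close>
    below.\<close>
  have "n\<^sup>2 \<le> m * (\<Sum>w\<in>V. card {u \<in> V. (w, u) \<in> - E})"
    unfolding n_def
    by (rule card_square_le_clique_bound)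
      (use assms in \<open>auto simp: irrefl_def sym_def\<close>)
  also have "(\<Sum>w\<in>V. card {u \<in> V. (w, u) \<in> - E}) = (\<Sum>w\<in>V. card (M w) + 1)"
  proof (rule sum.cong[OF refl])
    fix w assume "w \<in> V"
    then have "{u \<in> V. (w, u) \<in> - E} = insert w (M w)"
      using \<open>irrefl E\<close> by (auto simp: M_def irrefl_def)
    moreover have "w \<notin> M w" by (simp add: M_def)
    ultimately show "card {u \<in> V. (w, u) \<in> - E} = card (M w) + 1" using finM by simp
  qed
  also have "\<dots> = (\<Sum>w\<in>V. card (M w)) + n" by (subst sum.distrib) (simp add: n_def)
  finally have "real (n\<^sup>2) \<le> real (m * ((\<Sum>w\<in>V. card (M w)) + n))" by (simp only: of_nat_le_iff)
  then have turan: "real n * y - real n \<le> (\<Sum>w\<in>V. real (card (M w)))"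
    using mpos by (simp add: y_def field_simps power2_eq_square)

  \<comment> \<open>The tangent point: the average of \<open>card (M w)\<close> is at least
    \<open>y - 1\<close>, and the tangent bound subtracts 3 more. At this point the averaged bound
    is exactly \<open>x ^ 4\<close>.\<close>
  define x where "x = y - 4"
  have x: "x \<ge> 2 * real m ^ 2" unfolding x_def by (rule fourth_power_shift_estimate(2)[OF mpos(2) y])
  then have "x \<ge> 0" by (meson order_trans zero_le_mult_iff zero_le_numeral zero_le_power2)
  have "real n * x ^ 4 = 4 * x ^ 3 * (real n * y - real n - 3 * real n) - 3 * x ^ 4 * real n"
    unfolding x_def by algebra
  also have "\<dots> \<le> 4 * x ^ 3 * ((\<Sum>w\<in>V. real (card (M w))) - 3 * real n) - 3 * x ^ 4 * real n"
    using turan \<open>x \<ge> 0\<close> by (intro diff_right_mono mult_left_mono) auto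
  also have "\<dots> = (\<Sum>w\<in>V. 4 * x ^ 3 * (real (card (M w)) - 3) - 3 * x ^ 4)"
    by (simp add: sum_subtractf sum_distrib_left n_def algebra_simps)
  also have "\<dots> \<le> (\<Sum>w\<in>V. real (card (P w)) * q)"
  proof (rule sum_mono)
    fix w
    have "M w \<subseteq> V" by (auto simp: M_def)
    then show "4 * x ^ 3 * (real (card (M w)) - 3) - 3 * x ^ 4 \<le> real (card (P w)) * q"
      unfolding q_def P_def
      by (intro count_induced_P4_ge[OF \<open>sym E\<close> \<open>irrefl E\<close> finM \<open>m \<ge> 2\<close> x]) (use cl ind in blast)+
  qed
  also have "\<dots> = real (\<Sum>w\<in>V. card (P w)) * q" by (simp add: sum_distrib_right)
  also have "\<dots> \<le> real n ^ 4 * t * q"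
  proof (rule mult_right_mono[OF upper])
    have "real m ^ 2 \<ge> 4" using power_mono[OF mpos(2), of 2] by simp
    then show "q \<ge> 0" by (simp add: q_def)
  qed
  \<comment> \<open>Since \<open>n = m * y\<close>, dividing \<open>n ^ 4\<close> by
    \<open>m ^ 12\<close> leaves \<open>y ^ 4 / m ^ 8\<close>. The exponent 12 is chosen so that
    this \<open>m ^ 8\<close> matches the leading term of \<open>q\<close>.\<close>
  finally have "real n * x ^ 4 \<le> real n * (q * y ^ 4 / real m ^ 8)"
    using mpos by (simp add: t_def y_def field_simps power_numeral_reduce)
  then have "real m ^ 8 * x ^ 4 \<le> q * y ^ 4"
    using npos mpos by (simp add: field_simps)
  then show False using fourth_power_shift_estimate(1)[OF mpos(2) y] by (simp add: x_def q_def)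
qed

section \<open>Large connected components\<close>

text \<open>One representative from each component gives an independent set, so there are at most
  \<open>m\<close> components and the largest has the required share.\<close>

lemma ex_large_component:
  assumes "sym E" "finite D" "D \<noteq> {}"
    and ind: "\<And>I. I \<subseteq> D \<Longrightarrow> pairwise (\<lambda>u v. (u, v) \<notin> E) I \<Longrightarrow> card I \<le> m"
  shows "\<exists>A\<subseteq>D. A \<noteq> {} \<and> card D \<le> m * card A \<and> (\<forall>x\<in>A. \<forall>y\<in>A. (x, y) \<in> rtrancl_on A E)"
proof -
  define cls where "cls x = {y. (x, y) \<in> rtrancl_on D E}" for x
  have clsD: "cls x \<subseteq> D" for x by (auto simp: cls_def dest: in_rtrancl_on_in_F)
  have symD': "sym (rtrancl_on D E)" using \<open>sym E\<close> by (simp add: rtrancl_on_sym)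
  have refl: "x \<in> cls x" if "x \<in> D" for x using that by (simp add: cls_def)
  have cls_eq: "cls x = cls y" if "(x, y) \<in> rtrancl_on D E" for x y
    using that symD[OF symD'] by (auto simp: cls_def intro: rtrancl_on_trans)
  obtain I where I: "I \<subseteq> D" "inj_on cls I" "cls ` D = cls ` I"
    using subset_image_inj[of "cls ` D" cls D] by auto
  have "finite I" using I \<open>finite D\<close> finite_subset by blast
  have "(u, v) \<notin> E" if "u \<in> I" "v \<in> I" "u \<noteq> v" for u v
  proof
    assume "(u, v) \<in> E"
    then have "(u, v) \<in> rtrancl_on D E" using that I by (auto intro: rtrancl_on_into_rtrancl_on)
    then show False using cls_eq that I(2) by (auto simp: inj_on_def)
  qed
  then have "card I \<le> m" using I by (intro ind) (auto simp: pairwise_def)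
  have "I \<noteq> {}" using I \<open>D \<noteq> {}\<close> by auto
  then obtain i where i: "i \<in> I" and imax: "\<And>j. j \<in> I \<Longrightarrow> card (cls j) \<le> card (cls i)"
    using Max_in[of "(\<lambda>i. card (cls i)) ` I"] Max_ge[of "(\<lambda>i. card (cls i)) ` I"] \<open>finite I\<close>
    by fastforce
  define A where "A = cls i"
  have "D \<subseteq> (\<Union>j\<in>I. cls j)" using refl I(3) by blast
  then have "card D \<le> card (\<Union>j\<in>I. cls j)"
    using \<open>finite I\<close> \<open>finite D\<close> clsD finite_subset by (intro card_mono) blast+
  also have "\<dots> \<le> (\<Sum>j\<in>I. card (cls j))" using \<open>finite I\<close> by (rule card_UN_le)
  also have "\<dots> \<le> card I * card A" unfolding A_def using imax sum_bounded_above[of I "\<lambda>j. card (cls j)"] by simp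
  also have "\<dots> \<le> m * card A" using \<open>card I \<le> m\<close> by simp
  finally have "card D \<le> m * card A" .
  \<comment> \<open>A walk in \<open>D\<close> starting at \<open>i\<close> never leaves the class
    of \<open>i\<close>, so it is a walk inside \<open>A\<close>, as connectivity of the induced
    subgraph demands.\<close>
  have from_i: "(i, x) \<in> rtrancl_on A E" if "x \<in> A" for x
  proof -
    have "(i, x) \<in> rtrancl_on D E" using that by (simp add: A_def cls_def)
    then show ?thesis
    proof (induction rule: rtrancl_on_induct)
      case base
      then show ?case by (simp add: A_def cls_def)
    next
      case (step y z)
      then have "z \<in> A" by (auto simp: A_def cls_def intro: rtrancl_on_into_rtrancl_on)
      then show ?case using step by (auto intro: rtrancl_on_into_rtrancl_on)
    qed
  qed
  have "sym (rtrancl_on A E)" using \<open>sym E\<close> by (simp add: rtrancl_on_sym)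
  then have "\<forall>x\<in>A. \<forall>y\<in>A. (x, y) \<in> rtrancl_on A E"
    using from_i by (meson rtrancl_on_trans symD)
  moreover have "A \<noteq> {}" using refl[of i] i I(1) by (auto simp: A_def)
  ultimately show ?thesis using \<open>card D \<le> m * card A\<close> clsD A_def by blast
qed

text \<open>\<open>connected\<close> means strong connectivity of the symmetric closure, so the
  walks have to be carried over to \<open>mk_symmetric\<close>.\<close>

lemma connected_induce_subgraphI:
  assumes "A \<noteq> {}" "\<And>x y. x \<in> A \<Longrightarrow> y \<in> A \<Longrightarrow> (x, y) \<in> rtrancl_on A (parcs G)"
  shows "connected (with_proj G \<restriction> A)"
proof -
  define H where "H = mk_symmetric (with_proj G \<restriction> A)"
  have verts: "pverts H = A" by (simp add: H_def mk_symmetric_def)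
  have arcs: "(u, v) \<in> parcs H" if "(u, v) \<in> parcs G" "u \<in> A" "v \<in> A" for u v
    using that by (force simp: H_def mk_symmetric_def induce_subgraph_def)
  have "(x, y) \<in> rtrancl_on A (parcs H)" if "(x, y) \<in> rtrancl_on A (parcs G)" for x y
    using that
  proof (induction rule: rtrancl_on_induct)
    case (step y z)
    then show ?case using arcs[of y z] by (auto intro: rtrancl_on_into_rtrancl_on)
  qed simp
  then have "strongly_connected (with_proj H)"
    using assms by (auto simp: strongly_connected_def reachable_def verts)
  then show ?thesis by (simp add: connected_def H_def)
qed

section \<open>Recognising an induced \<open>P5\<close>\<close>

lemma contains_induced_P5I:
  assumes "pair_graph G" and p4: "induced_P4 (parcs G) a b c d" and "(d, w) \<in> parcs G"
    and nonadj: "(a, w) \<notin> parcs G" "(b, w) \<notin> parcs G" "(c, w) \<notin> parcs G"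
  shows "contains_induced_copy G (path_graph 5)"
proof -
  interpret pair_graph G by fact
  have sym: "(v, u) \<in> parcs G" if "(u, v) \<in> parcs G" for u v using that arcs_symmetric by blast
  have irr: "(u, u) \<notin> parcs G" for u using no_loops by fastforce
  note adj = p4[unfolded induced_P4_def] \<open>(d, w) \<in> parcs G\<close> nonadj
  have nonadj_rev: "(c, a) \<notin> parcs G" "(d, a) \<notin> parcs G" "(d, b) \<notin> parcs G"
    "(w, a) \<notin> parcs G" "(w, b) \<notin> parcs G" "(w, c) \<notin> parcs G"
    using adj sym by blast+
  define S where "S = {a, b, c, d, w}"
  have "S \<subseteq> pverts G" using adj in_arcsD1 in_arcsD2 unfolding S_def by blast
  \<comment> \<open>Distinctness follows from the adjacency pattern: \<open>w\<close> is a neighbour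
    of \<open>d\<close>, unlike \<open>a\<close>, \<open>b\<close> and \<open>d\<close>, and a
    non-neighbour of \<open>b\<close>, unlike \<open>c\<close>.\<close>
  have dist: "distinct [a, b, c, d, w]"
    using adj nonadj_rev irr by auto
  define f where "f = nth [a, b, c, d, w]"
  have f: "f 0 = a" "f 1 = b" "f (Suc 0) = b" "f 2 = c" "f 3 = d" "f 4 = w" by (simp_all add: f_def)
  \<comment> \<open>Arcs are sent to pairs of images with the projections as end maps, so that
    \<open>app_iso\<close> yields the induced subgraph literally, as \<open>digraph_iso\<close>
    requires.\<close>
  define h where "h = \<lparr>iso_verts = f, iso_arcs = \<lambda>(i, j). (f i, f j), iso_head = snd, iso_tail = fst\<rparr>"
  have verts5: "{..<5::nat} = {0, 1, 2, 3, 4}" by auto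
  have arcs5: "parcs (path_graph 5) = {(0,1), (1,0), (1,2), (2,1), (2,3), (3,2), (3,4), (4,3)}"
  proof -
    have "parcs (path_graph 5) = (\<lambda>i. (i, i + 1)) ` {..<4} \<union> (\<lambda>i. (i + 1, i)) ` {..<4}"
      by (auto simp: path_graph_def)
    moreover have "{..<4::nat} = {0, 1, 2, 3}" by auto
    ultimately show ?thesis by (simp add: insert_commute del: One_nat_def)
  qed
  have inj: "inj_on f {..<5}"
    unfolding f_def using dist by (intro inj_on_nth) auto
  have "pre_digraph.digraph_isomorphism (with_proj (path_graph 5)) h"
    unfolding pre_digraph.digraph_isomorphism_def
  proof (intro conjI)
    show "wf_digraph (with_proj (path_graph 5))"
      by unfold_locales (auto simp: path_graph_def)
    show "inj_on (iso_verts h) (verts (with_proj (path_graph 5)))"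
      using inj by (simp add: h_def path_graph_def)
    show "inj_on (iso_arcs h) (arcs (with_proj (path_graph 5)))"
      using inj by (auto simp: h_def path_graph_def inj_on_def)
  qed (auto simp: h_def)
  moreover have "with_proj G \<restriction> S = app_iso h (with_proj (path_graph 5))"
  proof -
    have "f ` {..<5} = S" unfolding verts5 S_def by (simp add: f)
    moreover have "{e \<in> parcs G. fst e \<in> S \<and> snd e \<in> S} = (\<lambda>(i, j). (f i, f j)) ` parcs (path_graph 5)"
    proof -
      define L where "L = {(a,b), (b,a), (b,c), (c,b), (c,d), (d,c), (d,w), (w,d)}"
      have image: "(\<lambda>(i, j). (f i, f j)) ` parcs (path_graph 5) = L"
        unfolding arcs5 L_def by (simp add: f)
      have "(u, v) \<in> L" if "(u, v) \<in> parcs G" "u \<in> S" "v \<in> S" for u v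
        using that adj irr nonadj_rev unfolding S_def L_def by (elim insertE emptyE) simp_all
      moreover have "L \<subseteq> parcs G \<inter> S \<times> S"
        using adj sym unfolding L_def S_def by simp
      ultimately show ?thesis unfolding image by auto
    qed
    ultimately show ?thesis
      by (simp add: induce_subgraph_def app_iso_def h_def path_graph_def)
  qed
  ultimately show ?thesis
    using \<open>S \<subseteq> pverts G\<close> unfolding contains_induced_copy_def digraph_iso_def by blast
qed

lemma card_le_hom_number:
  assumes "finite (pverts G)" "homogeneous G S"
  shows "card S \<le> hom_number G"
proof -
  have "{card S |S. homogeneous G S} \<subseteq> card ` Pow (pverts G)"
    by (auto simp: homogeneous_def is_clique_def is_independent_def)
  then have "finite {card S |S. homogeneous G S}" using assms(1) by (meson finite_Pow_iff finite_imageI finite_subset)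
  then show ?thesis unfolding hom_number_def using assms(2) by (intro Max_ge) auto
qed

section \<open>Assembling the two sets\<close>

theorem theorem2p3:
  fixes G :: "'a pair_pre_digraph" and n m :: nat
  assumes "pair_graph G"
    and "n = card (pverts G)"
    and "\<not> contains_induced_copy G (path_graph 5)"
    and "m = hom_number G"
    and "m < n"
  shows "\<exists>A B. A \<subseteq> pverts G \<and> B \<subseteq> pverts G \<and> A \<inter> B = {} \<and>
           real (card A) \<ge> real n / real m ^ 13 \<and>
           real (card B) \<ge> real n / real m ^ 13 \<and>
           anticomplete G A B \<and>
           connected (with_proj G \<restriction> A) \<and>
           connected (with_proj G \<restriction> B)"
proof -
  interpret pair_graph G by fact
  define V E where "V = pverts G" and "E = parcs G"
  have fin: "finite V" using pair_finite_verts by (simp add: V_def)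
  have "sym E" using arcs_symmetric by (auto simp: E_def sym_def)
  have "irrefl E" using no_loops by (fastforce simp: E_def irrefl_def)
  have cl: "card K \<le> m" if "K \<subseteq> V" "pairwise (\<lambda>u v. (u, v) \<in> E) K" for K
    using that fin unfolding assms(4) V_def E_def
    by (intro card_le_hom_number) (auto simp: homogeneous_def is_clique_def pairwise_def)
  have ind: "card I \<le> m" if "I \<subseteq> V" "pairwise (\<lambda>u v. (u, v) \<notin> E) I" for I
    using that fin \<open>irrefl E\<close> unfolding assms(4) V_def E_def
    by (intro card_le_hom_number)
      (auto simp: homogeneous_def is_independent_def pairwise_def irrefl_def, metis)
  \<comment> \<open>As \<open>m < n\<close>, the whole vertex set is not a clique; a nonadjacent
    pair also forces \<open>m\<close> to be at least 2.\<close>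
  obtain u v where uv: "u \<in> V" "v \<in> V" "u \<noteq> v" "(u, v) \<notin> E"
    using cl[of V] assms(2,5) by (fastforce simp: V_def pairwise_def)
  then have "m \<ge> 2" using ind[of "{u, v}"] symD[OF \<open>sym E\<close>] by (force simp: pairwise_insert)
  show ?thesis
  proof (cases "n \<le> m ^ 13")
    case True
    then have "real n \<le> real m ^ 13" by (metis of_nat_le_iff of_nat_power)
    then have "real n / real m ^ 13 \<le> 1" using \<open>m \<ge> 2\<close> by (simp add: divide_le_eq)
    moreover have "connected (with_proj G \<restriction> {x})" for x
      by (rule connected_induce_subgraphI) auto
    ultimately show ?thesis
      using uv by (intro exI[of _ "{u}"] exI[of _ "{v}"]) (auto simp: V_def E_def anticomplete_def)
  next
    case False
    then obtain a b c where abc: "(a, b) \<in> E" "(b, c) \<in> E" "(a, c) \<notin> E"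
      and largeD: "real n / real m ^ 12 \<le> real (card {d \<in> V. induced_P4 E a b c d})"
      and largeW: "real n / real m ^ 12 \<le>
        real (card {w \<in> V. (a, w) \<notin> E \<and> (b, w) \<notin> E \<and> (c, w) \<notin> E})"
      using ex_P3_with_large_attachments[OF \<open>sym E\<close> \<open>irrefl E\<close> fin \<open>m \<ge> 2\<close> _ cl ind] assms(2)
      by (auto simp: V_def)
    define D W where "D = {d \<in> V. induced_P4 E a b c d}"
      and "W = {w \<in> V. (a, w) \<notin> E \<and> (b, w) \<notin> E \<and> (c, w) \<notin> E}"
    have anti: "anticomplete G D W"
      unfolding anticomplete_def D_def W_def E_def
      using contains_induced_P5I[OF assms(1)] assms(3) by blast
    \<comment> \<open>Vertices of \<open>D\<close> are neighbours of \<open>c\<close>, those of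
      \<open>W\<close> are not.\<close>
    have "D \<inter> W = {}" by (auto simp: D_def W_def induced_P4_def)
    have component: "\<exists>A\<subseteq>X. real n / real m ^ 13 \<le> real (card A) \<and> connected (with_proj G \<restriction> A)"
      if "X \<subseteq> V" "real n / real m ^ 12 \<le> real (card X)" for X
    proof -
      have "real n / real m ^ 12 > 0" using assms(5) \<open>m \<ge> 2\<close> by simp
      then have "X \<noteq> {}" using that(2) by auto
      have finX: "finite X" using that(1) fin by (rule finite_subset)
      have indX: "card I \<le> m" if "I \<subseteq> X" "pairwise (\<lambda>u v. (u, v) \<notin> E) I" for I
        using ind[OF subset_trans[OF that(1) \<open>X \<subseteq> V\<close>] that(2)] .
      then obtain A where A: "A \<subseteq> X" "A \<noteq> {}" "card X \<le> m * card A"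
        "\<forall>x\<in>A. \<forall>y\<in>A. (x, y) \<in> rtrancl_on A E"
        using ex_large_component[OF \<open>sym E\<close> finX \<open>X \<noteq> {}\<close>, of m] indX by metis
      have "real n / real m ^ 12 \<le> real m * real (card A)"
        using that(2) A(3) by (metis of_nat_le_iff of_nat_mult order_trans)
      then have "real n / real m ^ 13 \<le> real (card A)"
        using \<open>m \<ge> 2\<close> by (simp add: field_simps power_numeral_reduce)
      moreover have "connected (with_proj G \<restriction> A)"
        using A by (intro connected_induce_subgraphI) (auto simp: E_def)
      ultimately show ?thesis using A(1) by blast
    qed
    obtain A B where "A \<subseteq> D" "real n / real m ^ 13 \<le> real (card A)" "connected (with_proj G \<restriction> A)"
      "B \<subseteq> W" "real n / real m ^ 13 \<le> real (card B)" "connected (with_proj G \<restriction> B)"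
      using component[of D] component[of W] largeD largeW by (auto simp: D_def W_def)
    moreover have "D \<subseteq> pverts G" "W \<subseteq> pverts G" by (auto simp: D_def W_def V_def)
    moreover have "anticomplete G A B" "A \<inter> B = {}"
      using anti \<open>D \<inter> W = {}\<close> calculation unfolding anticomplete_def by blast+
    ultimately show ?thesis by (intro exI[of _ A] exI[of _ B]) auto
  qed
qed

end
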